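(* Let $a_{-1},a_0,a_1,a_2,b>0$ and $\gamma,\theta>1$ be constants and $T>0$. Let $\{Y_n\}_{n=0}^N$ be the tamed-splitting approximation with backstop, with stepsize $\tau=T/N$ and initial value $Y_0>0$, and suppose that $Y_0\le M_1$ for a constant $M_1$. Let $Y_0^*=Y_0$ and, for $0\le n\le N-1$, let $$Y_{n+1}^*=e^{-\lambda\tau}\big(Y_n+\tau F^{(\tau)}(Y_n)+b(1-\theta)\Delta W_n\big)$$ be the value proposed by the tamed-splitting step before any use of the backstop. Then for each $\varepsilon\in(0,1)$ there exists $\tau>0$ (of the form $\tau=T/N$, $N\in\mathbb N$) such that $$\mathbb P[\mathcal R_N]>1-\varepsilon,\qquad\text{where}\quad \mathcal R_N=\bigcap_{j=0}^{N}\{Y_j^*>0\}.$$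
   Context: $\{W_t\}_{t\ge0}$ is a one-dimensional Brownian motion on a filtered probability space $(\Omega,\mathcal F,\{\mathcal F_t\}_{t\ge0},\mathbb P)$ satisfying the usual hypotheses, $t_n=n\tau$, and $\Delta W_n=W_{t_{n+1}}-W_{t_n}$. $Y_0$ is deterministic. Set $\lambda=(\theta-1)a_1$ and, for $x>0$, $$F(x)=(\theta-1)\Big[a_2x^{\frac{\gamma-\theta}{1-\theta}}-a_{-1}x^{\frac{\theta+1}{\theta-1}}+a_0x^{\frac{\theta}{\theta-1}}+\tfrac12b^2\theta x^{-1}\Big],\qquad F^{(\tau)}(x)=\frac{F(x)}{1+\tau|F(x)|^2}.$$ Tamed-splitting method with backstop: given $Y_n>0$, form the proposal $Y^*_{n+1}=e^{-\lambda\tau}(Y_n+\tau F^{(\tau)}(Y_n)+b(1-\theta)\Delta W_n)$. If $Y^*_{n+1}>0$, set $Y_{n+1}=Y^*_{n+1}$. Otherwise let $Y_{n+1}$ be a positive, $\mathcal F_{t_{n+1}}$-measurable solution $z$ of the backward Euler equation $z=Y_n+(F(z)-\lambda z)\tau+b(1-\theta)\Delta W_n$. Thus $\mathcal R_N$ is the event that the backstop is never used on $[0,T]$. *)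

theory Defs
  imports "HOL-Probability.Probability"
begin

text \<open>
  Time is modelled by the type \<^typ>\<open>real\<close>. Every condition is imposed at nonnegative times only;
  the values of the filtration and of the process at negative times are irrelevant. This is why the
  library locale \<^locale>\<open>filtration\<close>, which constrains all indices of its type, is not used.
\<close>

locale usual_filtered_prob_space = prob_space M + complete_measure M
  for M :: "'w measure" +
  fixes Fil :: "real \<Rightarrow> 'w measure"
  assumes subalgebra_Fil: "0 \<le> t \<Longrightarrow> subalgebra M (Fil t)"
    and mono_Fil: "0 \<le> s \<Longrightarrow> s \<le> t \<Longrightarrow> sets (Fil s) \<subseteq> sets (Fil t)"
    and right_continuous_Fil: "0 \<le> t \<Longrightarrow> sets (Fil t) = (\<Inter>s\<in>{t<..}. sets (Fil s))"
    and null_sets_Fil: "null_sets M \<subseteq> sets (Fil 0)"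

text \<open>
  The second argument of \<^term>\<open>normal_density\<close> is the standard deviation. The measure
  \<open>vimage_algebra (space M) X borel\<close> carries the sigma-algebra generated by \<open>X\<close>.
\<close>

locale brownian_motion = usual_filtered_prob_space M Fil
  for M :: "'w measure" and Fil :: "real \<Rightarrow> 'w measure" +
  fixes W :: "real \<Rightarrow> 'w \<Rightarrow> real"
  assumes adapted: "0 \<le> t \<Longrightarrow> W t \<in> borel_measurable (Fil t)"
    and start: "AE \<omega> in M. W 0 \<omega> = 0"
    and continuous_paths: "AE \<omega> in M. continuous_on {0..} (\<lambda>t. W t \<omega>)"
    and normal_increments: "0 \<le> s \<Longrightarrow> s < t \<Longrightarrow>
      distributed M lborel (\<lambda>\<omega>. W t \<omega> - W s \<omega>) (normal_density 0 (sqrt (t - s)))"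
    and indep_increments: "0 \<le> s \<Longrightarrow> s < t \<Longrightarrow>
      indep_set (sets (Fil s))
        (sets (vimage_algebra (space M) (\<lambda>\<omega>. W t \<omega> - W s \<omega>) borel))"

text \<open>Coefficients: \<open>am1\<close> stands for $a_{-1}$. All powers are taken at \<open>x > 0\<close> only.\<close>

definition drift_F ::
    "real \<Rightarrow> real \<Rightarrow> real \<Rightarrow> real \<Rightarrow> real \<Rightarrow> real \<Rightarrow> real \<Rightarrow> real" where
  "drift_F am1 a0 a2 b \<gamma> \<theta> x =
     (\<theta> - 1) * (a2 * x powr ((\<gamma> - \<theta>) / (1 - \<theta>)) - am1 * x powr ((\<theta> + 1) / (\<theta> - 1))
       + a0 * x powr (\<theta> / (\<theta> - 1)) + 1 / 2 * b\<^sup>2 * \<theta> * inverse x)"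

definition tamed_F ::
    "real \<Rightarrow> real \<Rightarrow> real \<Rightarrow> real \<Rightarrow> real \<Rightarrow> real \<Rightarrow> real \<Rightarrow> real \<Rightarrow> real" where
  "tamed_F am1 a0 a2 b \<gamma> \<theta> \<tau> x =
     drift_F am1 a0 a2 b \<gamma> \<theta> x / (1 + \<tau> * \<bar>drift_F am1 a0 a2 b \<gamma> \<theta> x\<bar>\<^sup>2)"

definition proposal ::
    "real \<Rightarrow> real \<Rightarrow> real \<Rightarrow> real \<Rightarrow> real \<Rightarrow> real \<Rightarrow> real \<Rightarrow> real \<Rightarrow> real \<Rightarrow> real \<Rightarrow> real" where
  "proposal am1 a0 a1 a2 b \<gamma> \<theta> \<tau> y dW =
     exp (- ((\<theta> - 1) * a1) * \<tau>) * (y + \<tau> * tamed_F am1 a0 a2 b \<gamma> \<theta> \<tau> y + b * (1 - \<theta>) * dW)"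

definition backward_euler_solution ::
    "real \<Rightarrow> real \<Rightarrow> real \<Rightarrow> real \<Rightarrow> real \<Rightarrow> real \<Rightarrow> real \<Rightarrow> real \<Rightarrow> real \<Rightarrow> real \<Rightarrow> real \<Rightarrow> bool" where
  "backward_euler_solution am1 a0 a1 a2 b \<gamma> \<theta> \<tau> y dW z \<longleftrightarrow>
     z = y + (drift_F am1 a0 a2 b \<gamma> \<theta> z - (\<theta> - 1) * a1 * z) * \<tau> + b * (1 - \<theta>) * dW"

text \<open>
  The backward Euler equation may have several positive solutions, so the scheme is a relation: any
  choice in the backstop branch is allowed as long as it is measurable with respect to the
  sigma-algebra at the new time point. (In the other branch this measurability is automatic.)
  \<open>Y\<close> is the approximation and \<open>Ys\<close> the sequence of proposals, constrained on \<open>{0..N}\<close> only.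
\<close>

definition tamed_splitting_backstop ::
    "'w measure \<Rightarrow> (real \<Rightarrow> 'w measure) \<Rightarrow> (real \<Rightarrow> 'w \<Rightarrow> real) \<Rightarrow>
     real \<Rightarrow> real \<Rightarrow> real \<Rightarrow> real \<Rightarrow> real \<Rightarrow> real \<Rightarrow> real \<Rightarrow> real \<Rightarrow> nat \<Rightarrow> real \<Rightarrow>
     (nat \<Rightarrow> 'w \<Rightarrow> real) \<Rightarrow> (nat \<Rightarrow> 'w \<Rightarrow> real) \<Rightarrow> bool" where
  "tamed_splitting_backstop M Fil W am1 a0 a1 a2 b \<gamma> \<theta> \<tau> N Y0 Y Ys \<longleftrightarrow>
     (\<forall>\<omega>\<in>space M. Y 0 \<omega> = Y0 \<and> Ys 0 \<omega> = Y0) \<and>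
     (\<forall>n<N.
        Y (Suc n) \<in> borel_measurable (Fil (real (Suc n) * \<tau>)) \<and>
        (\<forall>\<omega>\<in>space M.
           let dW = W (real (Suc n) * \<tau>) \<omega> - W (real n * \<tau>) \<omega> in
             Ys (Suc n) \<omega> = proposal am1 a0 a1 a2 b \<gamma> \<theta> \<tau> (Y n \<omega>) dW \<and>
             (if Ys (Suc n) \<omega> > 0
              then Y (Suc n) \<omega> = Ys (Suc n) \<omega>
              else Y (Suc n) \<omega> > 0 \<and>
                backward_euler_solution am1 a0 a1 a2 b \<gamma> \<theta> \<tau> (Y n \<omega>) dW (Y (Suc n) \<omega>))))"

definition all_proposals_positive ::
    "'w measure \<Rightarrow> nat \<Rightarrow> (nat \<Rightarrow> 'w \<Rightarrow> real) \<Rightarrow> 'w set" where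
  "all_proposals_positive M N Ys = (\<Inter>j\<in>{0..N}. {\<omega> \<in> space M. Ys j \<omega> > 0})"

end

theory Submission
  imports Defs
begin

text \<open>
  The limiting equation $dY = (F(Y) - \lambda Y)\,dt + \sigma\,dW$, with $\sigma = b(\theta - 1)$ up
  to the sign of the noise, has a drift which near $0$ is at least $c/Y$ minus a constant, where
  $c = b^2\theta(\theta-1)/2$. Since $c - \sigma^2/2 = b^2(\theta-1)/2 > 0$, the drift is stronger
  than the threshold at which a Bessel process reaches $0$, so $-\ln Y$ is, up to terms of bounded
  growth, a supermartingale near $0$. The proof transfers this to the discrete scheme.

  The function \<open>log_barrier\<close> is $-\ln x$ plus the cubic polynomial that makes it vanish to fourth
  order at $1$. It can therefore be replaced by $0$ on $[1,\infty)$ without spoiling a second-order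
  expansion, so that large values of the scheme, where $F$ is not bounded, need no separate control.
  It is also frozen below a level $r$, since proposals may be negative; the resulting
  \<open>capped_barrier\<close> is bounded, decreasing and defined on the whole line.

  While the scheme stays above $2r$, a step of length $\tau$ raises the conditional expectation of
  the barrier by at most $\tau K + O(\tau^{3/2})$, where $K$ is \<^emph>\<open>independent of\<close> $r$
  (\<open>tamed_step_barrier\<close>, \<open>barrier_generator_bound\<close>); only the constant in the error
  term depends on $r$. Summing over the $N = T/\tau$ steps up to the first proposal below $2r$ bounds
  the probability of ever going below $2r$ by $(V(Y_0) + T(K+1))/V(2r)$ for the barrier $V$, once
  $\tau$ is small in terms of $r$ (\<open>level_crossing_prob_le\<close>). As $V(2r) \ge -\ln(2r) - 2$, this is
  less than $\varepsilon$ for small $r$. Before the first proposal below $2r$ all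
  proposals are accepted, so up to then the scheme is an explicit recursion and its values are the
  proposals themselves.
\<close>

section \<open>The logarithmic barrier\<close>

text \<open>
  With $u = x - 1$ this is the remainder of the third-order Taylor polynomial of
  $-\ln(1+u)$. Its derivative $u^3/(1+u)$ changes sign only at $x = 1$.
\<close>

definition log_barrier :: "real \<Rightarrow> real" where
  "log_barrier x = (x - 1) - (x - 1)\<^sup>2 / 2 + (x - 1) ^ 3 / 3 - ln x"

text \<open>
  The first and second derivatives, in the factored forms that show their signs.
\<close>

definition log_barrier' :: "real \<Rightarrow> real" where
  "log_barrier' x = (x - 1) ^ 3 / x"

definition log_barrier'' :: "real \<Rightarrow> real" where
  "log_barrier'' x = (x - 1)\<^sup>2 * (1 + 2 * x) / x\<^sup>2"

lemma log_barrier_has_derivative: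
  assumes "0 < x"
  shows "(log_barrier has_real_derivative log_barrier' x) (at x)"
proof -
  have "(log_barrier has_real_derivative 1 - (x - 1) + (x - 1)\<^sup>2 - 1 / x) (at x)"
    unfolding log_barrier_def using assms
    by (auto intro!: derivative_eq_intros simp: power2_eq_square field_simps)
  also have "1 - (x - 1) + (x - 1)\<^sup>2 - 1 / x = log_barrier' x"
    using assms by (simp add: log_barrier'_def field_simps power2_eq_square power3_eq_cube)
  finally show ?thesis .
qed

lemma log_barrier_one [simp]: "log_barrier 1 = 0"
  by (simp add: log_barrier_def)

lemma log_barrier_antimono:
  assumes "0 < x" "x \<le> y" "y \<le> 1"
  shows "log_barrier y \<le> log_barrier x"
proof (rule DERIV_nonpos_imp_nonincreasing[OF assms(2)])
  fix z assume "x \<le> z" "z \<le> y"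
  then show "\<exists>D. DERIV log_barrier z :> D \<and> D \<le> 0"
    using assms log_barrier_has_derivative[of z]
    by (intro exI[of _ "log_barrier' z"])
       (auto simp: log_barrier'_def power3_eq_cube mult_nonneg_nonpos divide_nonpos_pos)
qed

lemma log_barrier_nonneg:
  assumes "0 < x"
  shows "0 \<le> log_barrier x"
proof (cases "x \<le> 1")
  case True
  then show ?thesis using log_barrier_antimono[of x 1] assms by simp
next
  case False
  have "log_barrier 1 \<le> log_barrier x"
  proof (rule DERIV_nonneg_imp_nondecreasing[of 1 x])
    show "1 \<le> x" using False by simp
    fix z :: real assume "1 \<le> z" "z \<le> x"
    then show "\<exists>D. DERIV log_barrier z :> D \<and> 0 \<le> D"
      using log_barrier_has_derivative[of z]
      by (intro exI[of _ "log_barrier' z"]) (auto simp: log_barrier'_def)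
  qed
  then show ?thesis by simp
qed

lemma log_barrier_ge_minus_ln:
  assumes "0 < x" "x \<le> 1"
  shows "- ln x - 2 \<le> log_barrier x"
proof -
  have "(1 - x)\<^sup>2 \<le> 1" "(1 - x) ^ 3 \<le> 1"
    using assms by (auto intro!: power_le_one)
  moreover have "(x - 1)\<^sup>2 = (1 - x)\<^sup>2" "(x - 1) ^ 3 = - ((1 - x) ^ 3)"
    by (simp_all add: power2_eq_square power3_eq_cube algebra_simps)
  ultimately show ?thesis using assms unfolding log_barrier_def by linarith
qed

lemma ln_add_one_ge_cubic:
  fixes v :: real
  assumes "- (1 / 2) \<le> v"
  shows "v - v\<^sup>2 / 2 - \<bar>v\<bar> ^ 3 \<le> ln (1 + v)"
proof (cases "0 \<le> v")
  case True
  let ?f = "\<lambda>v::real. ln (1 + v) - v + v\<^sup>2 / 2"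
  have "?f 0 \<le> ?f v"
  proof (rule DERIV_nonneg_imp_nondecreasing[OF True])
    fix z :: real assume "0 \<le> z" "z \<le> v"
    then show "\<exists>D. DERIV ?f z :> D \<and> 0 \<le> D"
      by (intro exI[of _ "1 / (1 + z) - 1 + z"])
         (auto intro!: derivative_eq_intros simp: field_simps)
  qed
  then have "0 \<le> ln (1 + v) - v + v\<^sup>2 / 2" by simp
  moreover have "0 \<le> \<bar>v\<bar> ^ 3" by simp
  ultimately show ?thesis by linarith
next
  case False
  let ?f = "\<lambda>v::real. ln (1 + v) - v + v\<^sup>2 / 2 - v ^ 3"
  have "?f 0 \<le> ?f v"
  proof (rule DERIV_nonpos_imp_nonincreasing[of v 0])
    show "v \<le> 0" using False by simp
    fix z :: real assume z: "v \<le> z" "z \<le> 0"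
    have "1 / (1 + z) - 1 + z - 3 * z\<^sup>2 = - (z\<^sup>2 * (2 + 3 * z)) / (1 + z)"
      using z assms by (simp add: field_simps power2_eq_square)
    also have "\<dots> \<le> 0"
      using z assms by (intro divide_nonpos_pos) auto
    finally have "1 / (1 + z) - 1 + z - 3 * z\<^sup>2 \<le> 0" .
    then show "\<exists>D. DERIV ?f z :> D \<and> D \<le> 0"
      using z assms by (intro exI[of _ "1 / (1 + z) - 1 + z - 3 * z\<^sup>2"])
         (auto intro!: derivative_eq_intros)
  qed
  moreover have "\<bar>v\<bar> ^ 3 = - (v ^ 3)"
    using False by (simp add: power3_eq_cube)
  ultimately show ?thesis by (simp add: algebra_simps)
qed

lemma log_barrier''_nonneg: "0 < x \<Longrightarrow> 0 \<le> log_barrier'' x"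
  by (simp add: log_barrier''_def)

lemma log_barrier''_le:
  assumes "0 < x" "x \<le> 1"
  shows "log_barrier'' x \<le> 1 / x\<^sup>2"
proof -
  have "(x - 1)\<^sup>2 * (1 + 2 * x) = 1 - x\<^sup>2 * (3 - 2 * x)"
    by (simp add: power2_eq_square algebra_simps)
  also have "\<dots> \<le> 1" using assms by simp
  finally show ?thesis
    unfolding log_barrier''_def using assms by (simp add: divide_right_mono)
qed

lemma log_barrier'_ge:
  assumes "0 < x" "x \<le> 1"
  shows "- (1 / x) \<le> log_barrier' x" and "log_barrier' x \<le> 0"
proof -
  have *: "(x - 1) ^ 3 = - ((1 - x) ^ 3)" by (simp add: power3_eq_cube algebra_simps)
  have "(1 - x) ^ 3 \<le> 1" using assms by (intro power_le_one) auto
  then have "(1 - x) ^ 3 / x \<le> 1 / x" using assms by (intro divide_right_mono) auto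
  then show "- (1 / x) \<le> log_barrier' x"
    unfolding log_barrier'_def * by simp
  show "log_barrier' x \<le> 0"
    unfolding log_barrier'_def * using assms by simp
qed

text \<open>
  For the logarithm this is the cubic bound at $v = h/y$; the polynomial part is a cubic, whose
  expansion has the exact remainder $h^3/3$. The condition on $h$ keeps $1 + v$ away from $0$.
\<close>

lemma log_barrier_taylor:
  assumes "0 < y" "- (y / 2) \<le> h"
  shows "log_barrier (y + h) \<le>
    log_barrier y + log_barrier' y * h + log_barrier'' y / 2 * h\<^sup>2 + (1 / y ^ 3 + 1) * \<bar>h\<bar> ^ 3"
proof -
  define v where "v = h / y"
  have h: "h = y * v" using assms by (simp add: v_def)
  have v: "- (1 / 2) \<le> v" using assms by (simp add: v_def field_simps)
  have "ln (y + h) = ln y + ln (1 + v)"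
    using assms v ln_mult[of y "1 + v"] by (simp add: h algebra_simps)
  also have "\<dots> \<ge> ln y + (v - v\<^sup>2 / 2 - \<bar>v\<bar> ^ 3)"
    using ln_add_one_ge_cubic[OF v] by simp
  finally have ln: "ln y + (v - v\<^sup>2 / 2 - \<bar>v\<bar> ^ 3) \<le> ln (y + h)" .
  have d1: "log_barrier' y = 1 - (y - 1) + (y - 1)\<^sup>2 - 1 / y"
    using assms by (simp add: log_barrier'_def field_simps power2_eq_square power3_eq_cube)
  have d2: "log_barrier'' y = - 1 + 2 * (y - 1) + 1 / y\<^sup>2"
    using assms by (simp add: log_barrier''_def field_simps power2_eq_square)
  have p1: "log_barrier' y * h = (1 - (y - 1) + (y - 1)\<^sup>2) * h - v"
    unfolding d1 v_def by (simp add: algebra_simps)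
  have p2: "log_barrier'' y / 2 * h\<^sup>2 = (- 1 + 2 * (y - 1)) / 2 * h\<^sup>2 + v\<^sup>2 / 2"
    unfolding d2 v_def by (simp add: algebra_simps power_divide add_divide_distrib diff_divide_distrib)
  have p3: "(1 / y ^ 3 + 1) * \<bar>h\<bar> ^ 3 = \<bar>v\<bar> ^ 3 + \<bar>h\<bar> ^ 3"
    unfolding v_def using assms by (simp add: algebra_simps power_divide abs_divide)
  have p4: "h ^ 3 / 3 \<le> \<bar>h\<bar> ^ 3"
    using abs_ge_self[of "h ^ 3"] zero_le_power[of "\<bar>h\<bar>" 3] unfolding power_abs by linarith
  have poly: "(y + h - 1) - (y + h - 1)\<^sup>2 / 2 + (y + h - 1) ^ 3 / 3 =
     (y - 1) - (y - 1)\<^sup>2 / 2 + (y - 1) ^ 3 / 3 + (1 - (y - 1) + (y - 1)\<^sup>2) * h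
       + (- 1 + 2 * (y - 1)) / 2 * h\<^sup>2 + h ^ 3 / 3"
    by (simp add: field_simps power2_eq_square power3_eq_cube)
  show ?thesis
    unfolding p1 p2 p3 log_barrier_def using ln p4 poly by linarith
qed

text \<open>
  Both modifications only lower the values on the positive half-line, which is the direction needed
  for an upper bound on the barrier after a step.
\<close>

definition capped_barrier :: "real \<Rightarrow> real \<Rightarrow> real" where
  "capped_barrier r x = (if 1 \<le> x then 0 else log_barrier (max r x))"

lemma capped_barrier_eq: "r \<le> x \<Longrightarrow> x \<le> 1 \<Longrightarrow> capped_barrier r x = log_barrier x"
  by (auto simp: capped_barrier_def max_def)

lemma capped_barrier_ge_one [simp]: "1 \<le> x \<Longrightarrow> capped_barrier r x = 0"
  by (simp add: capped_barrier_def)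

lemma capped_barrier_antimono:
  assumes "0 < r" "r \<le> 1" "x \<le> y"
  shows "capped_barrier r y \<le> capped_barrier r x"
  using assms log_barrier_antimono[of "max r x" "max r y"] log_barrier_nonneg[of "max r x"]
  by (auto simp: capped_barrier_def max_def split: if_splits)

lemma capped_barrier_nonneg: "0 < r \<Longrightarrow> 0 \<le> capped_barrier r x"
  using log_barrier_nonneg[of "max r x"] by (auto simp: capped_barrier_def)

lemma capped_barrier_le:
  assumes "0 < r" "r \<le> 1"
  shows "capped_barrier r x \<le> log_barrier r"
  using assms log_barrier_antimono[of r "max r x"] log_barrier_nonneg[of r]
  by (auto simp: capped_barrier_def)

lemma borel_measurable_capped_barrier [measurable]:
  "capped_barrier r \<in> borel_measurable borel"
  unfolding capped_barrier_def[abs_def] log_barrier_def by measurable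

text \<open>
  The barrier is not smooth at $r$, but an increment that leads from above $2r$ to below $r$ is
  longer than $r$. There the cubic term alone, with a constant depending on $r$, exceeds the upper
  bound \<open>log_barrier r\<close> of the barrier, and the other terms are nonnegative because the
  barrier is decreasing and convex.
\<close>

lemma capped_barrier_taylor:
  assumes "0 < r"
  obtains C where "0 \<le> C"
    "\<And>y h. 2 * r \<le> y \<Longrightarrow> y \<le> 1 \<Longrightarrow> capped_barrier r (y + h) \<le>
      log_barrier y + log_barrier' y * h + log_barrier'' y / 2 * h\<^sup>2 + C * \<bar>h\<bar> ^ 3"
proof
  let ?C = "1 / r ^ 3 + 1 + log_barrier r / r ^ 3"
  have Ur: "0 \<le> log_barrier r" using log_barrier_nonneg assms by simp
  show "0 \<le> ?C" using Ur assms by simp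
  fix y h :: real assume y: "2 * r \<le> y" "y \<le> 1"
  have y0: "0 < y" using y assms by simp
  show "capped_barrier r (y + h) \<le>
      log_barrier y + log_barrier' y * h + log_barrier'' y / 2 * h\<^sup>2 + ?C * \<bar>h\<bar> ^ 3"
  proof (cases "- r \<le> h")
    case True
    have "capped_barrier r (y + h) \<le> log_barrier (y + h)"
      using True y assms log_barrier_nonneg[of "y + h"] by (auto simp: capped_barrier_def max_def)
    also have "\<dots> \<le> log_barrier y + log_barrier' y * h + log_barrier'' y / 2 * h\<^sup>2
        + (1 / y ^ 3 + 1) * \<bar>h\<bar> ^ 3"
      using True y y0 by (intro log_barrier_taylor) auto
    also have "(1 / y ^ 3 + 1) * \<bar>h\<bar> ^ 3 \<le> ?C * \<bar>h\<bar> ^ 3"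
    proof (rule mult_right_mono)
      have "1 / y ^ 3 \<le> 1 / r ^ 3"
        using y assms by (intro divide_left_mono power_mono) auto
      moreover have "0 \<le> log_barrier r / r ^ 3" using Ur assms by simp
      ultimately show "1 / y ^ 3 + 1 \<le> ?C" by simp
    qed simp
    finally show ?thesis by simp
  next
    case False
    have "r ^ 3 \<le> \<bar>h\<bar> ^ 3" using False assms by (intro power_mono) auto
    then have "log_barrier r * 1 \<le> log_barrier r * (\<bar>h\<bar> ^ 3 / r ^ 3)"
      using Ur assms by (intro mult_left_mono) (auto simp: field_simps)
    then have 1: "log_barrier r \<le> log_barrier r / r ^ 3 * \<bar>h\<bar> ^ 3" by simp
    have 2: "0 \<le> log_barrier' y * h"
      using log_barrier'_ge(2)[OF y0 y(2)] False assms by (intro mult_nonpos_nonpos) auto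
    have 3: "0 \<le> log_barrier'' y / 2 * h\<^sup>2" using log_barrier''_nonneg[OF y0] by simp
    have 4: "0 \<le> (1 / r ^ 3 + 1) * \<bar>h\<bar> ^ 3" using assms by simp
    have "capped_barrier r (y + h) \<le> log_barrier r"
      using y assms by (intro capped_barrier_le) auto
    then show ?thesis
      using 1 2 3 4 log_barrier_nonneg[OF y0] unfolding distrib_right by linarith
  qed
qed

section \<open>Tamed steps and the barrier\<close>

lemma abs_diff_cubed_le:
  fixes x y :: real
  shows "\<bar>x - y\<bar> ^ 3 \<le> 4 * (\<bar>x\<bar> ^ 3 + \<bar>y\<bar> ^ 3)"
proof -
  have "\<bar>x - y\<bar> ^ 3 \<le> (\<bar>x\<bar> + \<bar>y\<bar>) ^ 3"
    by (intro power_mono) auto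
  also have "\<dots> = 4 * (\<bar>x\<bar> ^ 3 + \<bar>y\<bar> ^ 3) - 3 * (\<bar>x\<bar> + \<bar>y\<bar>) * (\<bar>x\<bar> - \<bar>y\<bar>)\<^sup>2"
    by (simp add: power2_eq_square power3_eq_cube algebra_simps)
  also have "\<dots> \<le> 4 * (\<bar>x\<bar> ^ 3 + \<bar>y\<bar> ^ 3)" by simp
  finally show ?thesis .
qed

text \<open>
  Taming changes $f$ by $\tau f^3/(1 + \tau f^2)$, which is of first order in $\tau$ as long as $f$
  stays bounded.
\<close>

lemma taming_error:
  fixes f \<tau> :: real
  assumes "0 \<le> \<tau>" "\<bar>f\<bar> \<le> B"
  shows "\<bar>f / (1 + \<tau> * \<bar>f\<bar>\<^sup>2)\<bar> \<le> B" and "f - \<tau> * B ^ 3 \<le> f / (1 + \<tau> * \<bar>f\<bar>\<^sup>2)"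
proof -
  have p: "1 \<le> 1 + \<tau> * \<bar>f\<bar>\<^sup>2" using assms by simp
  then have p0: "0 < 1 + \<tau> * \<bar>f\<bar>\<^sup>2" by linarith
  have "\<bar>f / (1 + \<tau> * \<bar>f\<bar>\<^sup>2)\<bar> \<le> \<bar>f\<bar>"
    using p p0 by (simp add: divide_le_eq mult_le_cancel_left1)
  then show "\<bar>f / (1 + \<tau> * \<bar>f\<bar>\<^sup>2)\<bar> \<le> B" using assms by simp
  have "f - f / (1 + \<tau> * \<bar>f\<bar>\<^sup>2) = \<tau> * f ^ 3 / (1 + \<tau> * \<bar>f\<bar>\<^sup>2)"
    using p0 by (simp add: field_simps power2_eq_square power3_eq_cube)
  also have "\<dots> \<le> \<tau> * \<bar>f\<bar> ^ 3 / (1 + \<tau> * \<bar>f\<bar>\<^sup>2)"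
    using p0 assms abs_ge_self[of "f ^ 3"] unfolding power_abs
    by (intro divide_right_mono mult_left_mono) auto
  also have "\<dots> \<le> \<tau> * \<bar>f\<bar> ^ 3"
    using p p0 assms divide_left_mono[of 1 "1 + \<tau> * \<bar>f\<bar>\<^sup>2" "\<tau> * \<bar>f\<bar> ^ 3"] by simp
  also have "\<dots> \<le> \<tau> * B ^ 3"
    using assms by (intro mult_left_mono power_mono) auto
  finally show "f - \<tau> * B ^ 3 \<le> f / (1 + \<tau> * \<bar>f\<bar>\<^sup>2)" by simp
qed

text \<open>
  However large $f$ is, the tamed increment is at most of the order of the noise. This is what
  prevents a large value of the scheme from jumping below $0$ through the drift.
\<close>

lemma tamed_increment_le_sqrt:
  fixes f \<tau> :: real
  assumes "0 < \<tau>"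
  shows "\<bar>\<tau> * (f / (1 + \<tau> * \<bar>f\<bar>\<^sup>2))\<bar> \<le> sqrt \<tau>"
proof -
  define s where "s = sqrt \<tau>"
  have s: "0 < s" "\<tau> = s * s" using assms by (simp_all add: s_def)
  have "0 < 1 + \<tau> * \<bar>f\<bar>\<^sup>2" using assms by (simp add: add_pos_nonneg)
  moreover have "s * \<bar>f\<bar> \<le> 1 + s * s * \<bar>f\<bar>\<^sup>2"
  proof -
    have "0 \<le> (s * \<bar>f\<bar> - 1)\<^sup>2" by simp
    moreover have "0 \<le> s * \<bar>f\<bar>" using s by simp
    ultimately show ?thesis by (simp add: power2_eq_square algebra_simps)
  qed
  then have "s * (s * \<bar>f\<bar>) \<le> s * (1 + s * s * \<bar>f\<bar>\<^sup>2)"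
    using s by (intro mult_left_mono) auto
  ultimately have "\<tau> * \<bar>f\<bar> / (1 + \<tau> * \<bar>f\<bar>\<^sup>2) \<le> s"
    by (simp add: pos_divide_le_eq s(2) mult.assoc)
  then show ?thesis
    using \<open>0 < 1 + \<tau> * \<bar>f\<bar>\<^sup>2\<close> assms by (simp add: abs_mult s_def)
qed

lemma damped_ge:
  fixes \<mu> \<tau> x :: real
  assumes "0 \<le> \<mu> * \<tau>"
  shows "x - \<mu> * \<tau> * \<bar>x\<bar> \<le> exp (- \<mu> * \<tau>) * x"
proof -
  have q: "1 - \<mu> * \<tau> \<le> exp (- \<mu> * \<tau>)" "exp (- \<mu> * \<tau>) \<le> 1"
    using exp_ge_add_one_self[of "- \<mu> * \<tau>"] assms by auto
  have "(1 - exp (- \<mu> * \<tau>)) * x \<le> (1 - exp (- \<mu> * \<tau>)) * \<bar>x\<bar>"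
    using q by (intro mult_left_mono) auto
  also have "\<dots> \<le> \<mu> * \<tau> * \<bar>x\<bar>"
    using q by (intro mult_right_mono) auto
  finally show ?thesis by (simp add: algebra_simps)
qed

text \<open>
  The generator of the comparison diffusion with drift $c/y - C$ and volatility $\sigma$, applied to
  the barrier. With $w = 1/y$ it is at most $-(c - \sigma^2/2) w^2 + (3c + C) w$, a concave quadratic
  in $w$; the right-hand side is its maximum. The bound does not depend on $y$, and this is where
  the hypothesis $c > \sigma^2/2$ enters.
\<close>

lemma barrier_generator_bound:
  fixes c \<sigma> C y :: real
  assumes "0 < y" "y \<le> 1" "\<sigma>\<^sup>2 / 2 < c" "0 \<le> C"
  shows "log_barrier' y * (c / y - C) + log_barrier'' y / 2 * \<sigma>\<^sup>2
    \<le> (3 * c + C)\<^sup>2 / (4 * (c - \<sigma>\<^sup>2 / 2))"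
proof -
  define w where "w = 1 / y"
  define \<kappa> where "\<kappa> = c - \<sigma>\<^sup>2 / 2"
  have \<kappa>: "0 < \<kappa>" and c: "0 \<le> c"
    using assms zero_le_power2[of \<sigma>] unfolding \<kappa>_def by linarith+
  have "0 \<le> y\<^sup>2 * (3 - y)" using assms by simp
  then have "(y - 1) ^ 3 \<le> 3 * y - 1"
    by (simp add: power2_eq_square power3_eq_cube algebra_simps)
  then have "(y - 1) ^ 3 * (c / y\<^sup>2) \<le> (3 * y - 1) * (c / y\<^sup>2)"
    using c by (intro mult_right_mono) auto
  then have 1: "log_barrier' y * (c / y) \<le> 3 * c * w - c * w\<^sup>2"
    using assms by (simp add: log_barrier'_def w_def power2_eq_square field_simps)
  have 2: "- (C * log_barrier' y) \<le> C * w"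
    using mult_left_mono[OF log_barrier'_ge(1)[OF assms(1,2)] assms(4)] by (simp add: w_def)
  have 3: "log_barrier'' y / 2 * \<sigma>\<^sup>2 \<le> \<sigma>\<^sup>2 / 2 * w\<^sup>2"
    using mult_right_mono[OF log_barrier''_le[OF assms(1,2)], of "\<sigma>\<^sup>2 / 2"]
    by (simp add: w_def power_divide mult.commute)
  have "0 \<le> (2 * \<kappa> * w - (3 * c + C))\<^sup>2" by simp
  then have "((3 * c + C) * w - \<kappa> * w\<^sup>2) * (4 * \<kappa>) \<le> (3 * c + C)\<^sup>2"
    by (simp add: power2_eq_square algebra_simps)
  then have 4: "(3 * c + C) * w - \<kappa> * w\<^sup>2 \<le> (3 * c + C)\<^sup>2 / (4 * \<kappa>)"
    using \<kappa> by (simp add: pos_le_divide_eq)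
  show ?thesis
    using 1 2 3 4 unfolding \<kappa>_def by (simp add: algebra_simps)
qed

text \<open>
  Coefficients of $g$ and $g^2 - \tau$ in the second-order expansion of the barrier at $y$, for the
  increment $\tau(c/y - C) - s g$. They vanish for $y \ge 1$, where the expansion is made at $1$. Below
  $2r$ they are set to $0$ so that they are bounded on the whole line; such $y$ never occur before
  the crossing time.
\<close>

definition step_linear_coeff :: "real \<Rightarrow> real \<Rightarrow> real \<Rightarrow> real \<Rightarrow> real \<Rightarrow> real \<Rightarrow> real" where
  "step_linear_coeff r c C \<tau> s y =
     (if y \<in> {2 * r..<1}
      then - s * (log_barrier' y + log_barrier'' y * (\<tau> * (c / y - C))) else 0)"

definition step_quadratic_coeff :: "real \<Rightarrow> real \<Rightarrow> real \<Rightarrow> real" where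
  "step_quadratic_coeff r s y =
     (if y \<in> {2 * r..<1} then log_barrier'' y / 2 * s\<^sup>2 else 0)"

lemma borel_measurable_step_coeffs [measurable]:
  "step_linear_coeff r c C \<tau> s \<in> borel_measurable borel"
  "step_quadratic_coeff r s \<in> borel_measurable borel"
  unfolding step_linear_coeff_def[abs_def] step_quadratic_coeff_def[abs_def]
    log_barrier'_def log_barrier''_def by measurable

lemma continuous_on_Icc_bounded:
  fixes f :: "real \<Rightarrow> real"
  assumes "continuous_on {a..b} f"
  obtains D where "0 \<le> D" "\<And>x. x \<in> {a..b} \<Longrightarrow> \<bar>f x\<bar> \<le> D"
proof -
  have "bounded (f ` {a..b})"
    using assms by (intro compact_imp_bounded compact_continuous_image) auto
  then obtain D where "0 < D" "\<forall>y\<in>f ` {a..b}. norm y \<le> D"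
    unfolding bounded_pos by blast
  then show thesis by (intro that[of D]) auto
qed

lemma step_coeffs_bounded:
  assumes "0 < r"
  obtains D where "\<And>y. \<bar>step_linear_coeff r c C \<tau> s y\<bar> \<le> D"
    "\<And>y. \<bar>step_quadratic_coeff r s y\<bar> \<le> D"
proof -
  have "continuous_on {2 * r..1}
      (\<lambda>y. - s * (log_barrier' y + log_barrier'' y * (\<tau> * (c / y - C))))"
    unfolding log_barrier'_def log_barrier''_def using assms by (intro continuous_intros) auto
  from continuous_on_Icc_bounded[OF this] obtain D1 where D1: "0 \<le> D1"
    "\<And>y. y \<in> {2 * r..1} \<Longrightarrow>
      \<bar>- s * (log_barrier' y + log_barrier'' y * (\<tau> * (c / y - C)))\<bar> \<le> D1" by blast
  have "continuous_on {2 * r..1} (\<lambda>y. log_barrier'' y / 2 * s\<^sup>2)"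
    unfolding log_barrier''_def using assms by (intro continuous_intros) auto
  from continuous_on_Icc_bounded[OF this] obtain D2 where D2: "0 \<le> D2"
    "\<And>y. y \<in> {2 * r..1} \<Longrightarrow> \<bar>log_barrier'' y / 2 * s\<^sup>2\<bar> \<le> D2" by blast
  show thesis
  proof (rule that[of "max D1 D2"])
    show "\<bar>step_linear_coeff r c C \<tau> s y\<bar> \<le> max D1 D2" for y
    proof (cases "y \<in> {2 * r..<1}")
      case True
      then show ?thesis using D1(2)[of y] unfolding step_linear_coeff_def by auto
    next
      case False
      then show ?thesis using D1(1) by (auto simp: step_linear_coeff_def)
    qed
    show "\<bar>step_quadratic_coeff r s y\<bar> \<le> max D1 D2" for y
    proof (cases "y \<in> {2 * r..<1}")
      case True
      then show ?thesis using D2(2)[of y] unfolding step_quadratic_coeff_def by auto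
    next
      case False
      then show ?thesis using D2(1) by (auto simp: step_quadratic_coeff_def)
    qed
  qed
qed

lemma square_le_mult_sqrt:
  fixes \<tau> :: real
  assumes "0 \<le> \<tau>" "\<tau> \<le> 1"
  shows "\<tau>\<^sup>2 \<le> \<tau> * sqrt \<tau>"
proof -
  have "\<tau> \<le> sqrt \<tau>" using assms by (intro real_le_rsqrt) (simp add: power2_eq_square mult_left_le)
  then show ?thesis using assms by (simp add: power2_eq_square mult_left_mono)
qed

text \<open>
  The one-step estimate, for every realisation $g$ of the Brownian increment. The terms in $g$ and
  $g^2 - \tau$ have zero mean and the last one has mean of order $\tau^{3/2}$. The constant multiplying
  $\tau$ is free of $r$, $B$ and $\tau$.

  Since the barrier decreases, the new value may be replaced by any lower bound. For $y < 1$ this is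
  $y + \tau(c/y - C_1 - \mu - 1) - s g$: the part $\mu$ is the damping to first order, and the
  part $1$ pays for the taming error and the rest of the damping, which are of order $\tau^2$. For $y \ge 1$ the step starts at $1$ instead with an
  increment of order $\sqrt\tau$, and since the barrier is flat at $1$ only the cubic error remains.
\<close>

lemma tamed_step_barrier:
  fixes F :: "real \<Rightarrow> real" and r \<mu> \<sigma> c C1 B :: real
  assumes r: "0 < r" "2 * r \<le> 1" and \<mu>: "0 \<le> \<mu>" and \<sigma>: "0 < \<sigma>" "\<sigma>\<^sup>2 / 2 < c" and C1: "0 \<le> C1"
    and lower: "\<And>y. 0 < y \<Longrightarrow> y \<le> 1 \<Longrightarrow> c / y - C1 \<le> F y"
    and bound: "\<And>y. 2 * r \<le> y \<Longrightarrow> y \<le> 1 \<Longrightarrow> \<bar>F y\<bar> \<le> B"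
  obtains \<tau>0 C where "0 < \<tau>0" "0 \<le> C"
    "\<And>\<tau> y g. 0 < \<tau> \<Longrightarrow> \<tau> \<le> \<tau>0 \<Longrightarrow> 2 * r \<le> y \<Longrightarrow>
      capped_barrier r (exp (- \<mu> * \<tau>) * (y + \<tau> * (F y / (1 + \<tau> * \<bar>F y\<bar>\<^sup>2)) - \<sigma> * g))
      \<le> capped_barrier r y
        + \<tau> * ((3 * c + (C1 + \<mu> + 1))\<^sup>2 / (4 * (c - \<sigma>\<^sup>2 / 2)))
        + step_linear_coeff r c (C1 + \<mu> + 1) \<tau> (exp (- \<mu> * \<tau>) * \<sigma>) y * g
        + step_quadratic_coeff r (exp (- \<mu> * \<tau>) * \<sigma>) y * (g\<^sup>2 - \<tau>)
        + C * (\<tau> * sqrt \<tau> + \<bar>g\<bar> ^ 3)"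
proof -
  obtain C0 where C0: "0 \<le> C0"
    "\<And>y h. 2 * r \<le> y \<Longrightarrow> y \<le> 1 \<Longrightarrow> capped_barrier r (y + h) \<le>
      log_barrier y + log_barrier' y * h + log_barrier'' y / 2 * h\<^sup>2 + C0 * \<bar>h\<bar> ^ 3"
    using capped_barrier_taylor[OF r(1)] by blast
  have B: "0 \<le> B" using bound[of 1] r by auto
  have c: "0 \<le> c" using \<sigma>(2) zero_le_power2[of \<sigma>] by linarith
  define C2 where "C2 = C1 + \<mu> + 1"
  define D where "D = c / (2 * r) + C2"
  define E where "E = D + \<mu> + 1"
  define K where "K = (3 * c + C2)\<^sup>2 / (4 * (c - \<sigma>\<^sup>2 / 2))"
  define C where "C = D\<^sup>2 / (8 * r\<^sup>2) + 4 * C0 * (E ^ 3 + \<sigma> ^ 3)"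
  define \<tau>0 where "\<tau>0 = min 1 (1 / (B ^ 3 + \<mu> * B + 1))"
  have C2: "0 \<le> C2" unfolding C2_def using C1 \<mu> by simp
  have D: "0 \<le> D" unfolding D_def using C2 c r by simp
  have E: "0 \<le> E" unfolding E_def using D \<mu> by simp
  have K: "0 \<le> K" unfolding K_def using \<sigma> by simp
  have \<tau>0: "0 < \<tau>0" unfolding \<tau>0_def using B \<mu>
    by (simp add: add_nonneg_pos)
  have C: "0 \<le> C" unfolding C_def using C0(1) E \<sigma> by simp
  have step: "capped_barrier r (exp (- \<mu> * \<tau>) * (y + \<tau> * (F y / (1 + \<tau> * \<bar>F y\<bar>\<^sup>2)) - \<sigma> * g))
      \<le> capped_barrier r y + \<tau> * K
        + step_linear_coeff r c C2 \<tau> (exp (- \<mu> * \<tau>) * \<sigma>) y * g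
        + step_quadratic_coeff r (exp (- \<mu> * \<tau>) * \<sigma>) y * (g\<^sup>2 - \<tau>)
        + C * (\<tau> * sqrt \<tau> + \<bar>g\<bar> ^ 3)"
    if \<tau>: "0 < \<tau>" "\<tau> \<le> \<tau>0" and y: "2 * r \<le> y" for \<tau> y g
  proof -
    define q where "q = exp (- \<mu> * \<tau>)"
    define G where "G = F y / (1 + \<tau> * \<bar>F y\<bar>\<^sup>2)"
    define s where "s = q * \<sigma>"
    have \<tau>1: "\<tau> \<le> 1" using \<tau>(2) unfolding \<tau>0_def by simp
    have rt: "0 < sqrt \<tau>" "sqrt \<tau> \<le> 1" "\<tau> \<le> sqrt \<tau>"
      using \<tau>(1) \<tau>1 by (auto intro!: real_le_rsqrt simp: power2_eq_square mult_left_le)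
    have \<mu>\<tau>: "0 \<le> \<mu> * \<tau>" using \<mu> \<tau> by simp
    have q: "0 < q" "q \<le> 1" unfolding q_def using \<mu>\<tau> by auto
    have s: "0 < s" "s \<le> \<sigma>" unfolding s_def using q \<sigma> by (auto simp: mult_left_le_one_le)
    (* One constant E serves both cases: D controls the drift increment for y < 1, and 1 + \<mu> the
       one of order sqrt \<tau> for y \<ge> 1. *)
    have cubic: "C0 * \<bar>d - s * g\<bar> ^ 3 \<le> 4 * C0 * (E ^ 3 + \<sigma> ^ 3) * (\<tau> * sqrt \<tau> + \<bar>g\<bar> ^ 3)"
      if d: "\<bar>d\<bar> \<le> E * sqrt \<tau>" for d
    proof -
      have "\<bar>d\<bar> ^ 3 \<le> (E * sqrt \<tau>) ^ 3" using d by (intro power_mono) auto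
      also have "\<dots> = E ^ 3 * (\<tau> * sqrt \<tau>)"
        using \<tau> by (simp add: power_mult_distrib power3_eq_cube)
      also have "\<dots> \<le> (E ^ 3 + \<sigma> ^ 3) * (\<tau> * sqrt \<tau>)"
        using \<sigma> \<tau> by (intro mult_right_mono) auto
      finally have 1: "\<bar>d\<bar> ^ 3 \<le> (E ^ 3 + \<sigma> ^ 3) * (\<tau> * sqrt \<tau>)" .
      have "\<bar>s * g\<bar> ^ 3 \<le> (\<sigma> * \<bar>g\<bar>) ^ 3"
        using s by (intro power_mono) (auto simp: abs_mult mult_right_mono)
      also have "\<dots> \<le> (E ^ 3 + \<sigma> ^ 3) * \<bar>g\<bar> ^ 3"
        unfolding power_mult_distrib using E by (intro mult_right_mono) auto
      finally have 2: "\<bar>s * g\<bar> ^ 3 \<le> (E ^ 3 + \<sigma> ^ 3) * \<bar>g\<bar> ^ 3" .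
      have "\<bar>d - s * g\<bar> ^ 3 \<le> 4 * ((E ^ 3 + \<sigma> ^ 3) * (\<tau> * sqrt \<tau> + \<bar>g\<bar> ^ 3))"
        using abs_diff_cubed_le[of d "s * g"] 1 2 by (simp add: distrib_left)
      from mult_left_mono[OF this C0(1)] show ?thesis
        by (simp only: mult.assoc mult.left_commute[of C0 4])
    qed
    have C_ge: "4 * C0 * (E ^ 3 + \<sigma> ^ 3) \<le> C" unfolding C_def by simp
    have rest: "0 \<le> \<tau> * sqrt \<tau> + \<bar>g\<bar> ^ 3" using \<tau> by simp
    have noise_split: "exp (- \<mu> * \<tau>) * (y + \<tau> * (F y / (1 + \<tau> * \<bar>F y\<bar>\<^sup>2)) - \<sigma> * g)
        = q * (y + \<tau> * G) - s * g"
      unfolding q_def G_def s_def by (simp add: algebra_simps)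
    have damp: "x - \<mu> * \<tau> * \<bar>x\<bar> \<le> q * x" for x
      unfolding q_def by (rule damped_ge[OF \<mu>\<tau>])
    show ?thesis
    proof (cases "y < 1")
      case True
      have y0: "0 < y" using y r by simp
      define d where "d = \<tau> * (c / y - C2)"
      have Fb: "\<bar>F y\<bar> \<le> B" using bound y True by simp
      have G: "\<bar>G\<bar> \<le> B" "F y - \<tau> * B ^ 3 \<le> G"
        unfolding G_def using taming_error[of \<tau> "F y" B] Fb \<tau> by auto
      have "\<bar>y + \<tau> * G\<bar> \<le> 1 + \<tau> * B"
      proof -
        have "\<bar>\<tau> * G\<bar> \<le> \<tau> * B" using mult_left_mono[OF G(1), of \<tau>] \<tau> by (simp add: abs_mult)
        then show ?thesis using y0 True by linarith
      qed
      then have "\<mu> * \<tau> * \<bar>y + \<tau> * G\<bar> \<le> \<mu> * \<tau> * (1 + \<tau> * B)"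
        using \<mu>\<tau> by (intro mult_left_mono) auto
      then have "y + \<tau> * G - \<mu> * \<tau> * (1 + \<tau> * B) \<le> q * (y + \<tau> * G)"
        using damp[of "y + \<tau> * G"] by linarith
      moreover have "\<tau> * (c / y - C1 - \<tau> * B ^ 3) \<le> \<tau> * G"
        using lower[OF y0] True G(2) \<tau> by (intro mult_left_mono) auto
      moreover have "d \<le> \<tau> * (c / y - C1 - \<tau> * B ^ 3) - \<mu> * \<tau> * (1 + \<tau> * B)"
      proof -
        have p: "0 < B ^ 3 + \<mu> * B + 1" using B \<mu> by (simp add: add_nonneg_pos)
        have "\<tau> \<le> 1 / (B ^ 3 + \<mu> * B + 1)" using \<tau>(2) unfolding \<tau>0_def by simp
        then have "\<tau> * (B ^ 3 + \<mu> * B + 1) \<le> 1" using p by (simp add: pos_le_divide_eq)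
        then have "\<tau> * (B ^ 3 + \<mu> * B) \<le> 1" using \<tau> by (simp add: distrib_left)
        then have "c / y - C2 \<le> c / y - C1 - \<tau> * B ^ 3 - \<mu> * (1 + \<tau> * B)"
          unfolding C2_def by (simp add: algebra_simps)
        from mult_left_mono[OF this, of \<tau>] \<tau> show ?thesis
          unfolding d_def by (simp add: algebra_simps)
      qed
      ultimately have "y + d \<le> q * (y + \<tau> * G)" by linarith
      then have "capped_barrier r (q * (y + \<tau> * G) - s * g) \<le> capped_barrier r (y + (d - s * g))"
        using r by (intro capped_barrier_antimono) auto
      also have "\<dots> \<le> log_barrier y + log_barrier' y * (d - s * g)
          + log_barrier'' y / 2 * (d - s * g)\<^sup>2 + C0 * \<bar>d - s * g\<bar> ^ 3"
        using C0(2) y True by simp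
      also have "log_barrier y = capped_barrier r y"
        using capped_barrier_eq[of r y] y r True by simp
      also have "capped_barrier r y + log_barrier' y * (d - s * g)
          + log_barrier'' y / 2 * (d - s * g)\<^sup>2 + C0 * \<bar>d - s * g\<bar> ^ 3
        = capped_barrier r y + (log_barrier' y * d + log_barrier'' y / 2 * s\<^sup>2 * \<tau>)
          + step_linear_coeff r c C2 \<tau> s y * g
          + step_quadratic_coeff r s y * (g\<^sup>2 - \<tau>)
          + log_barrier'' y / 2 * d\<^sup>2 + C0 * \<bar>d - s * g\<bar> ^ 3"
        using y True unfolding step_linear_coeff_def step_quadratic_coeff_def d_def[symmetric]
        by (simp add: power2_eq_square field_simps)
      finally have main: "capped_barrier r (q * (y + \<tau> * G) - s * g) \<le>
          capped_barrier r y + (log_barrier' y * d + log_barrier'' y / 2 * s\<^sup>2 * \<tau>)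
          + step_linear_coeff r c C2 \<tau> s y * g
          + step_quadratic_coeff r s y * (g\<^sup>2 - \<tau>)
          + log_barrier'' y / 2 * d\<^sup>2 + C0 * \<bar>d - s * g\<bar> ^ 3" .
      have gen: "log_barrier' y * d + log_barrier'' y / 2 * s\<^sup>2 * \<tau> \<le> \<tau> * K"
      proof -
        have "s\<^sup>2 \<le> \<sigma>\<^sup>2" using s by (intro power_mono) auto
        then have "log_barrier'' y / 2 * s\<^sup>2 \<le> log_barrier'' y / 2 * \<sigma>\<^sup>2"
          using log_barrier''_nonneg[OF y0] by (intro mult_left_mono) auto
        then have "log_barrier' y * (c / y - C2) + log_barrier'' y / 2 * s\<^sup>2 \<le> K"
          using barrier_generator_bound[OF y0 _ \<sigma>(2) C2] True unfolding K_def by simp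
        from mult_left_mono[OF this, of \<tau>] \<tau> show ?thesis
          unfolding d_def by (simp add: algebra_simps)
      qed
      have "\<bar>c / y - C2\<bar> \<le> D"
      proof -
        have "c / y \<le> c / (2 * r)" "0 \<le> c / y" using c y r y0 by (auto intro!: divide_left_mono)
        then show ?thesis using C2 unfolding D_def by (simp add: abs_le_iff)
      qed
      then have dD: "\<bar>d\<bar> \<le> D * \<tau>" using \<tau> unfolding d_def by (simp add: abs_mult)
      also have "\<dots> \<le> E * sqrt \<tau>" unfolding E_def using rt D \<tau> \<mu> by (intro mult_mono) auto
      finally have dE: "\<bar>d\<bar> \<le> E * sqrt \<tau>" .
      have sq: "log_barrier'' y / 2 * d\<^sup>2 \<le> D\<^sup>2 / (8 * r\<^sup>2) * (\<tau> * sqrt \<tau> + \<bar>g\<bar> ^ 3)"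
      proof -
        have "d\<^sup>2 \<le> (D * \<tau>)\<^sup>2" using dD D \<tau> by (simp add: abs_le_square_iff[symmetric])
        also have "\<dots> \<le> D\<^sup>2 * (\<tau> * sqrt \<tau>)"
          unfolding power_mult_distrib using square_le_mult_sqrt[of \<tau>] \<tau> \<tau>1
          by (intro mult_left_mono) auto
        also have "\<dots> \<le> D\<^sup>2 * (\<tau> * sqrt \<tau> + \<bar>g\<bar> ^ 3)" by (intro mult_left_mono) auto
        finally have d2: "d\<^sup>2 \<le> D\<^sup>2 * (\<tau> * sqrt \<tau> + \<bar>g\<bar> ^ 3)" .
        have "log_barrier'' y / 2 \<le> 1 / (8 * r\<^sup>2)"
        proof -
          have "log_barrier'' y \<le> 1 / y\<^sup>2" using log_barrier''_le y0 True by simp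
          also have "\<dots> \<le> 1 / (2 * r)\<^sup>2" using y r y0 by (intro divide_left_mono power_mono) auto
          finally show ?thesis by (simp add: power_mult_distrib)
        qed
        then have "log_barrier'' y / 2 * d\<^sup>2 \<le>
            1 / (8 * r\<^sup>2) * (D\<^sup>2 * (\<tau> * sqrt \<tau> + \<bar>g\<bar> ^ 3))"
          using d2 by (intro mult_mono) auto
        then show ?thesis by simp
      qed
      have "C * (\<tau> * sqrt \<tau> + \<bar>g\<bar> ^ 3) = D\<^sup>2 / (8 * r\<^sup>2) * (\<tau> * sqrt \<tau> + \<bar>g\<bar> ^ 3)
          + 4 * C0 * (E ^ 3 + \<sigma> ^ 3) * (\<tau> * sqrt \<tau> + \<bar>g\<bar> ^ 3)"
        unfolding C_def by (rule distrib_right)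
      then show ?thesis
        unfolding noise_split unfolding q_def[symmetric] s_def[symmetric]
        using main gen sq cubic[OF dE] by linarith
    next
      case False
      then have y1: "1 \<le> y" by simp
      (* The tamed drift takes at most sqrt \<tau> from 1, the damping at most \<mu> sqrt \<tau>. *)
      define d where "d = - ((1 + \<mu>) * sqrt \<tau>)"
      have "\<bar>\<tau> * G\<bar> \<le> sqrt \<tau>" unfolding G_def by (rule tamed_increment_le_sqrt[OF \<tau>(1)])
      then have "1 - sqrt \<tau> \<le> y + \<tau> * G" using y1 by linarith
      then have "q * (1 - sqrt \<tau>) \<le> q * (y + \<tau> * G)" using q by (intro mult_left_mono) auto
      moreover have "1 - sqrt \<tau> - \<mu> * \<tau> * \<bar>1 - sqrt \<tau>\<bar> \<le> q * (1 - sqrt \<tau>)" by (rule damp)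
      moreover have "\<mu> * \<tau> * \<bar>1 - sqrt \<tau>\<bar> \<le> \<mu> * sqrt \<tau>"
      proof -
        have "\<tau> * \<bar>1 - sqrt \<tau>\<bar> \<le> sqrt \<tau> * 1"
          using rt \<tau> by (intro mult_mono) auto
        from mult_left_mono[OF this \<mu>] show ?thesis by (simp add: mult.assoc)
      qed
      ultimately have "1 + d \<le> q * (y + \<tau> * G)" unfolding d_def by (simp add: algebra_simps)
      then have "capped_barrier r (q * (y + \<tau> * G) - s * g) \<le> capped_barrier r (1 + (d - s * g))"
        using r by (intro capped_barrier_antimono) auto
      also have "\<dots> \<le> log_barrier 1 + log_barrier' 1 * (d - s * g)
          + log_barrier'' 1 / 2 * (d - s * g)\<^sup>2 + C0 * \<bar>d - s * g\<bar> ^ 3"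
        using r by (intro C0(2)) auto
      also have "\<dots> = C0 * \<bar>d - s * g\<bar> ^ 3"
        by (simp add: log_barrier'_def log_barrier''_def)
      also have "\<dots> \<le> 4 * C0 * (E ^ 3 + \<sigma> ^ 3) * (\<tau> * sqrt \<tau> + \<bar>g\<bar> ^ 3)"
      proof (rule cubic)
        show "\<bar>d\<bar> \<le> E * sqrt \<tau>"
          unfolding d_def E_def abs_minus_cancel using rt D \<mu> by (simp add: abs_mult)
      qed
      also have "\<dots> \<le> C * (\<tau> * sqrt \<tau> + \<bar>g\<bar> ^ 3)"
        using C_ge rest by (rule mult_right_mono)
      also have "\<dots> \<le> \<tau> * K + C * (\<tau> * sqrt \<tau> + \<bar>g\<bar> ^ 3)" using \<tau> K by simp
      finally show ?thesis
        unfolding noise_split unfolding q_def[symmetric] s_def[symmetric]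
        using y1 by (simp add: step_linear_coeff_def step_quadratic_coeff_def)
    qed
  qed
  show thesis
    by (rule that[OF \<tau>0 C]) (use step in \<open>simp add: K_def C2_def\<close>)
qed

section \<open>Brownian increments and level crossings\<close>

context brownian_motion
begin

lemma increment_moments:
  assumes "0 \<le> s" "s < t"
  defines "g \<equiv> \<lambda>\<omega>. W t \<omega> - W s \<omega>"
  shows "integrable M g" "expectation g = 0"
    and "integrable M (\<lambda>\<omega>. (g \<omega>)\<^sup>2)" "expectation (\<lambda>\<omega>. (g \<omega>)\<^sup>2) = t - s"
    and "integrable M (\<lambda>\<omega>. \<bar>g \<omega>\<bar> ^ 3)"
      "expectation (\<lambda>\<omega>. \<bar>g \<omega>\<bar> ^ 3) \<le> 2 * ((t - s) * sqrt (t - s))"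
proof -
  define sd where "sd = sqrt (t - s)"
  have sd: "0 < sd" "sd\<^sup>2 = t - s" using assms by (simp_all add: sd_def)
  have D: "distributed M lborel g (normal_density 0 sd)"
    using normal_increments[OF assms(1,2)] by (simp add: g_def sd_def)
  have transfer: "integrable M (\<lambda>\<omega>. h (g \<omega>))" "expectation (\<lambda>\<omega>. h (g \<omega>)) = v"
    if "h \<in> borel_measurable borel"
      "has_bochner_integral lborel (\<lambda>x. normal_density 0 sd x * h x) v" for h v
    using that(1) distributed_integrable[OF D, of h] distributed_integral[OF D, of h] that(2)
    by (auto simp: has_bochner_integral_iff)
  show "integrable M g" "expectation g = 0"
    using transfer[of "\<lambda>x. x" 0] normal_moment_odd[OF sd(1), of 0 0] by simp_all
  show "integrable M (\<lambda>\<omega>. (g \<omega>)\<^sup>2)" "expectation (\<lambda>\<omega>. (g \<omega>)\<^sup>2) = t - s"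
    using transfer[of "\<lambda>x. x\<^sup>2" "sd\<^sup>2"] normal_moment_even[OF sd(1), of 0 1] sd
    by (simp_all add: numeral_eq_Suc)
  have 3: "has_bochner_integral lborel (\<lambda>x. normal_density 0 sd x * \<bar>x\<bar> ^ 3)
      (2 * sd ^ 3 * sqrt (2 / pi))"
    using normal_moment_abs_odd[OF sd(1), of 0 1] by (simp add: numeral_eq_Suc)
  then show "integrable M (\<lambda>\<omega>. \<bar>g \<omega>\<bar> ^ 3)" using transfer[of "\<lambda>x. \<bar>x\<bar> ^ 3"] by simp
  have "expectation (\<lambda>\<omega>. \<bar>g \<omega>\<bar> ^ 3) = 2 * sd ^ 3 * sqrt (2 / pi)"
    using transfer(2)[of "\<lambda>x. \<bar>x\<bar> ^ 3", OF _ 3] by simp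
  also have "\<dots> \<le> 2 * sd ^ 3 * 1"
    using sd(1) pi_ge_two by (intro mult_left_mono) auto
  also have "sd ^ 3 = (t - s) * sd"
    using sd(2) by (simp add: power3_eq_cube power2_eq_square)
  finally show "expectation (\<lambda>\<omega>. \<bar>g \<omega>\<bar> ^ 3) \<le> 2 * ((t - s) * sqrt (t - s))"
    by (simp add: sd_def)
qed

lemma measurable_Fil_imp_measurable:
  assumes "0 \<le> s" "X \<in> borel_measurable (Fil s)"
  shows "X \<in> borel_measurable M"
  by (rule measurable_from_subalg[OF subalgebra_Fil[OF assms(1)] assms(2)])

text \<open>
  The increment over $[s,t]$ is independent of the past up to $s$, hence past-measurable
  factors separate from functions of the increment.
\<close>

lemma expectation_mult_increment:
  fixes X :: "'w \<Rightarrow> real" and h :: "real \<Rightarrow> real"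
  assumes "0 \<le> s" "s < t"
    and X: "X \<in> borel_measurable (Fil s)" "\<And>\<omega>. \<omega> \<in> space M \<Longrightarrow> \<bar>X \<omega>\<bar> \<le> D"
    and h: "h \<in> borel_measurable borel" "integrable M (\<lambda>\<omega>. h (W t \<omega> - W s \<omega>))"
  shows "integrable M (\<lambda>\<omega>. X \<omega> * h (W t \<omega> - W s \<omega>))"
    and "expectation (\<lambda>\<omega>. X \<omega> * h (W t \<omega> - W s \<omega>))
      = expectation X * expectation (\<lambda>\<omega>. h (W t \<omega> - W s \<omega>))"
proof -
  let ?g = "\<lambda>\<omega>. W t \<omega> - W s \<omega>"
  have [measurable]: "X \<in> borel_measurable M" "W t \<in> borel_measurable M" "W s \<in> borel_measurable M"
    using measurable_Fil_imp_measurable[OF assms(1) X(1)]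
      measurable_Fil_imp_measurable[OF _ adapted, of s] measurable_Fil_imp_measurable[OF _ adapted, of t]
      assms(1,2) by auto
  have sp: "space (Fil s) = space M"
    using subalgebra_Fil[OF assms(1)] by (simp add: subalgebra_def)
  have "indep_var borel X borel ?g"
    unfolding indep_var_eq
  proof (intro conjI)
    have sub: "sigma_sets (space M) {X -` A \<inter> space M |A. A \<in> sets borel} \<subseteq> sets (Fil s)"
      unfolding sp[symmetric] using measurable_sets[OF X(1)]
      by (intro sets.sigma_sets_subset) auto
    have "sigma_sets (space M) {?g -` A \<inter> space M |A. A \<in> sets borel}
        = sets (vimage_algebra (space M) ?g borel)"
      by (simp add: sets_vimage_algebra)
    then show "indep_set (sigma_sets (space M) {X -` A \<inter> space M |A. A \<in> sets borel})
        (sigma_sets (space M) {?g -` A \<inter> space M |A. A \<in> sets borel})"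
      using indep_increments[OF assms(1,2)] sub unfolding indep_set_def
      by (elim indep_sets_mono_sets) (auto split: bool.splits)
  qed simp_all
  from indep_var_compose[OF this measurable_ident h(1)]
  have indep: "indep_var borel X borel (\<lambda>\<omega>. h (?g \<omega>))"
    by (simp add: comp_def)
  have "integrable M X"
    by (rule integrable_const_bound[of _ D]) (use X(2) in auto)
  then show "integrable M (\<lambda>\<omega>. X \<omega> * h (?g \<omega>))"
    "expectation (\<lambda>\<omega>. X \<omega> * h (?g \<omega>)) = expectation X * expectation (\<lambda>\<omega>. h (?g \<omega>))"
    by (rule indep_var_integrable[OF indep _ h(2)], rule indep_var_lebesgue_integral[OF indep _ h(2)])
qed

text \<open>
  Let $A_n$ be the event that $Z$ has stayed above $\delta$ up to step $n$. The quantity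
  $E[1_{A_n} V(Z_n)] + H\,P(A_n^c)$ is a lower bound for the expectation of $V$ along the process
  stopped at its first value below $\delta$, because $V \ge H$ there. It grows by at most
  $a + 2C\tau^{3/2}$ per step: the terms with coefficients $L$ and $Q$ average to $0$,
  and $E|g|^3 \le 2\tau^{3/2}$. This is Markov's inequality for the stopped process, in a form in
  which neither the stopping time nor the value below $\delta$ appears.
\<close>

lemma level_crossing_prob_le:
  fixes Z :: "nat \<Rightarrow> 'w \<Rightarrow> real" and V L Q :: "real \<Rightarrow> real" and \<tau> a C D v0 H \<delta> :: real
  assumes \<tau>: "0 < \<tau>" and a: "0 \<le> a" and C: "0 \<le> C"
    and Z: "\<And>n. n \<le> N \<Longrightarrow> Z n \<in> borel_measurable (Fil (real n * \<tau>))"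
    and Z0: "\<And>\<omega>. \<omega> \<in> space M \<Longrightarrow> \<delta> \<le> Z 0 \<omega>" "\<And>\<omega>. \<omega> \<in> space M \<Longrightarrow> V (Z 0 \<omega>) \<le> v0"
    and V: "V \<in> borel_measurable borel"
    and V_bounds: "\<And>x. 0 \<le> V x" "\<And>x. V x \<le> D" "\<And>x. x < \<delta> \<Longrightarrow> H \<le> V x"
    and LQ: "L \<in> borel_measurable borel" "Q \<in> borel_measurable borel"
    and LQ_bounds: "\<And>x. \<bar>L x\<bar> \<le> D" "\<And>x. \<bar>Q x\<bar> \<le> D"
    and step: "\<And>n \<omega>. n < N \<Longrightarrow> \<omega> \<in> space M \<Longrightarrow> (\<forall>j\<le>n. \<delta> \<le> Z j \<omega>) \<Longrightarrow>
      V (Z (Suc n) \<omega>) \<le> V (Z n \<omega>) + a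
        + L (Z n \<omega>) * (W (real (Suc n) * \<tau>) \<omega> - W (real n * \<tau>) \<omega>)
        + Q (Z n \<omega>) * ((W (real (Suc n) * \<tau>) \<omega> - W (real n * \<tau>) \<omega>)\<^sup>2 - \<tau>)
        + C * \<bar>W (real (Suc n) * \<tau>) \<omega> - W (real n * \<tau>) \<omega>\<bar> ^ 3"
  shows "H * (1 - prob {\<omega> \<in> space M. \<forall>j\<le>N. \<delta> \<le> Z j \<omega>})
    \<le> v0 + real N * (a + 2 * C * (\<tau> * sqrt \<tau>))"
proof -
  define A where "A n = {\<omega> \<in> space M. \<forall>j\<le>n. \<delta> \<le> Z j \<omega>}" for n
  have sp: "space (Fil (real n * \<tau>)) = space M" for n
    using subalgebra_Fil[of "real n * \<tau>"] \<tau> by (simp add: subalgebra_def)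
  have A_Fil: "A n \<in> sets (Fil (real n * \<tau>))" if "n \<le> N" for n
  proof -
    have Zj: "Z j \<in> borel_measurable (Fil (real n * \<tau>))" if "j \<le> n" for j
    proof -
      have "subalgebra (Fil (real n * \<tau>)) (Fil (real j * \<tau>))"
        unfolding subalgebra_def sp using \<tau> \<open>j \<le> n\<close>
          mono_Fil[of "real j * \<tau>" "real n * \<tau>"] by simp
      from measurable_from_subalg[OF this Z] show ?thesis using \<open>j \<le> n\<close> \<open>n \<le> N\<close> by simp
    qed
    have "A n = (\<Inter>j\<in>{..n}. {\<omega> \<in> space (Fil (real n * \<tau>)). \<delta> \<le> Z j \<omega>})"
      unfolding A_def sp by auto
    also have "\<dots> \<in> sets (Fil (real n * \<tau>))"
      using Zj by (intro sets.finite_INT) (auto intro: borel_measurable_le[OF borel_measurable_const])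
    finally show ?thesis .
  qed
  have A_M: "A n \<in> sets M" if "n \<le> N" for n
    using A_Fil[OF that] subalgebra_Fil[of "real n * \<tau>"] \<tau> by (auto simp: subalgebra_def)
  have Z_M: "Z n \<in> borel_measurable M" if "n \<le> N" for n
    using Z[OF that] \<tau> by (intro measurable_Fil_imp_measurable) auto
  have D: "0 \<le> D" using LQ_bounds(1)[of 0] by linarith
  define u where "u n = expectation (\<lambda>\<omega>. indicator (A n) \<omega> * V (Z n \<omega>))" for n
  have V_int: "integrable M (\<lambda>\<omega>. indicator (A n) \<omega> * V (Z n \<omega>))" if n: "n \<le> N" for n
  proof (rule integrable_const_bound[of _ D])
    show "AE \<omega> in M. norm (indicator (A n) \<omega> * V (Z n \<omega>)) \<le> D"
      using V_bounds(1,2) D by (auto split: split_indicator simp: abs_of_nonneg)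
    show "(\<lambda>\<omega>. indicator (A n) \<omega> * V (Z n \<omega>)) \<in> borel_measurable M"
      by (intro borel_measurable_times borel_measurable_indicator A_M[OF n]
          measurable_compose[OF Z_M[OF n] V])
  qed
  have "u n + H * (1 - prob (A n)) \<le> v0 + real n * (a + 2 * C * (\<tau> * sqrt \<tau>))" if "n \<le> N" for n
    using that
  proof (induction n)
    case 0
    have "A 0 = space M" using Z0(1) by (auto simp: A_def)
    moreover have "u 0 \<le> expectation (\<lambda>\<omega>. v0)"
      unfolding u_def
    proof (rule integral_mono)
      show "indicator (A 0) \<omega> * V (Z 0 \<omega>) \<le> v0" if "\<omega> \<in> space M" for \<omega>
        using Z0(2)[OF that] \<open>A 0 = space M\<close> that by simp
    qed (use V_int in auto)
    ultimately show ?case by (simp add: prob_space)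
  next
    case (Suc n)
    then have n: "n \<le> N" "Suc n \<le> N" "n < N" by auto
    have t: "0 \<le> real n * \<tau>" "real n * \<tau> < real (Suc n) * \<tau>" using \<tau> by auto
    have len: "real (Suc n) * \<tau> - real n * \<tau> = \<tau>" by (simp add: algebra_simps)
    let ?g = "\<lambda>\<omega>. W (real (Suc n) * \<tau>) \<omega> - W (real n * \<tau>) \<omega>"
    note mom = increment_moments[OF t, unfolded len]
    have coeff_bound: "\<bar>indicator (A n) \<omega> * f (Z n \<omega>)\<bar> \<le> D"
      if "\<And>x. \<bar>f x\<bar> \<le> D" for f :: "real \<Rightarrow> real" and \<omega>
      by (cases "\<omega> \<in> A n") (simp_all add: that D)
    have coeff_meas: "(\<lambda>\<omega>. indicator (A n) \<omega> * f (Z n \<omega>)) \<in> borel_measurable (Fil (real n * \<tau>))"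
      if "f \<in> borel_measurable borel" for f :: "real \<Rightarrow> real"
      by (intro borel_measurable_times borel_measurable_indicator A_Fil[OF n(1)]
          measurable_compose[OF Z[OF n(1)] that])
    have lin: "integrable M (\<lambda>\<omega>. indicator (A n) \<omega> * L (Z n \<omega>) * ?g \<omega>)"
      "expectation (\<lambda>\<omega>. indicator (A n) \<omega> * L (Z n \<omega>) * ?g \<omega>) = 0"
      using expectation_mult_increment[where h = "\<lambda>x. x", OF t coeff_meas[OF LQ(1)]
          coeff_bound[of L, OF LQ_bounds(1)]
          measurable_ident_sets[OF refl] mom(1)] mom(2) by simp_all
    have sq_meas: "(\<lambda>x. x\<^sup>2 - \<tau>) \<in> borel_measurable borel" by measurable
    have int0: "integrable M (\<lambda>\<omega>. (?g \<omega>)\<^sup>2 - \<tau>)" using mom(3) by simp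
    have mean0: "expectation (\<lambda>\<omega>. (?g \<omega>)\<^sup>2 - \<tau>) = 0" using mom(3,4) by (simp add: prob_space)
    have quad: "integrable M (\<lambda>\<omega>. indicator (A n) \<omega> * Q (Z n \<omega>) * ((?g \<omega>)\<^sup>2 - \<tau>))"
      "expectation (\<lambda>\<omega>. indicator (A n) \<omega> * Q (Z n \<omega>) * ((?g \<omega>)\<^sup>2 - \<tau>)) = 0"
      using expectation_mult_increment[where h = "\<lambda>x. x\<^sup>2 - \<tau>", OF t coeff_meas[OF LQ(2)]
          coeff_bound[of Q, OF LQ_bounds(2)]
          sq_meas int0] mean0 by simp_all
    let ?lhs = "\<lambda>\<omega>. indicator (A (Suc n)) \<omega> * V (Z (Suc n) \<omega>)
        + H * (indicator (A n) \<omega> - indicator (A (Suc n)) \<omega>)"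
    let ?rhs = "\<lambda>\<omega>. indicator (A n) \<omega> * V (Z n \<omega>) + a
        + indicator (A n) \<omega> * L (Z n \<omega>) * ?g \<omega>
        + indicator (A n) \<omega> * Q (Z n \<omega>) * ((?g \<omega>)\<^sup>2 - \<tau>)
        + C * \<bar>?g \<omega>\<bar> ^ 3"
    have ind: "integrable M (indicator (A n) :: 'w \<Rightarrow> real)"
      "integrable M (indicator (A (Suc n)) :: 'w \<Rightarrow> real)"
      using A_M n by (auto simp: integrable_indicator_iff less_top[symmetric])
    have "expectation ?lhs \<le> expectation ?rhs"
    proof (rule integral_mono)
      show "integrable M ?lhs" using V_int[OF n(2)] ind by simp
      show "integrable M ?rhs" using V_int[OF n(1)] lin(1) quad(1) mom(5) by simp
      fix \<omega> assume \<omega>: "\<omega> \<in> space M"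
      show "?lhs \<omega> \<le> ?rhs \<omega>"
      proof (cases "\<omega> \<in> A n")
        case True
        (* If step n + 1 crosses the level, the left-hand side is H, which V reaches below \<delta>. *)
        have "?lhs \<omega> \<le> V (Z (Suc n) \<omega>)"
        proof (cases "\<omega> \<in> A (Suc n)")
          case False
          then have "Z (Suc n) \<omega> < \<delta>"
            using True \<omega> by (auto simp: A_def le_Suc_eq)
          then show ?thesis using V_bounds(3) True False by simp
        qed (use True in simp)
        also have "\<dots> \<le> ?rhs \<omega>"
          using step[OF n(3) \<omega>] True by (simp add: A_def)
        finally show ?thesis .
      next
        case False
        then have "\<omega> \<notin> A (Suc n)" using le_SucI unfolding A_def by blast
        then show ?thesis using False a C by simp
      qed
    qed
    moreover have "expectation ?lhs = u (Suc n) + H * (prob (A n) - prob (A (Suc n)))"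
      using V_int[OF n(2)] ind A_M n sets.sets_into_space by (simp add: u_def Int_absorb2)
    moreover have "expectation ?rhs = u n + a + C * expectation (\<lambda>\<omega>. \<bar>?g \<omega>\<bar> ^ 3)"
      using V_int[OF n(1)] lin quad mom(5) by (simp add: u_def prob_space)
    moreover have "C * expectation (\<lambda>\<omega>. \<bar>?g \<omega>\<bar> ^ 3) \<le> 2 * C * (\<tau> * sqrt \<tau>)"
      using mult_left_mono[OF mom(6) C] by simp
    ultimately have "u (Suc n) + H * (prob (A n) - prob (A (Suc n)))
        \<le> u n + a + 2 * C * (\<tau> * sqrt \<tau>)" by linarith
    then show ?case using Suc n by (simp add: algebra_simps)
  qed
  from this[of N] have "u N + H * (1 - prob (A N)) \<le> v0 + real N * (a + 2 * C * (\<tau> * sqrt \<tau>))"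
    by simp
  moreover have "0 \<le> u N" unfolding u_def using V_bounds(1) by (intro Bochner_Integration.integral_nonneg) auto
  ultimately show ?thesis by (simp add: A_def)
qed

end

section \<open>The tamed-splitting scheme\<close>

text \<open>
  On $(0,1]$ the terms with $a_0$ and $a_2$ help, whatever the sign of the exponent
  $(\gamma-\theta)/(1-\theta)$, and $x^{(\theta+1)/(\theta-1)} \le 1$.
\<close>

lemma drift_F_lower:
  assumes "0 < am1" "0 < a0" "0 < a2" "1 < \<theta>" "0 < x" "x \<le> 1"
  shows "(\<theta> - 1) * (1 / 2 * b\<^sup>2 * \<theta>) / x - (\<theta> - 1) * am1 \<le> drift_F am1 a0 a2 b \<gamma> \<theta> x"
proof -
  have "x powr ((\<theta> + 1) / (\<theta> - 1)) \<le> 1"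
    using assms by (intro powr_le1) auto
  then have "am1 * x powr ((\<theta> + 1) / (\<theta> - 1)) \<le> am1" using assms by simp
  moreover have "0 \<le> a2 * x powr ((\<gamma> - \<theta>) / (1 - \<theta>))" "0 \<le> a0 * x powr (\<theta> / (\<theta> - 1))"
    using assms by auto
  ultimately have "1 / 2 * b\<^sup>2 * \<theta> * inverse x - am1
      \<le> a2 * x powr ((\<gamma> - \<theta>) / (1 - \<theta>)) - am1 * x powr ((\<theta> + 1) / (\<theta> - 1))
       + a0 * x powr (\<theta> / (\<theta> - 1)) + 1 / 2 * b\<^sup>2 * \<theta> * inverse x" by linarith
  then have "(\<theta> - 1) * (1 / 2 * b\<^sup>2 * \<theta> * inverse x - am1) \<le> drift_F am1 a0 a2 b \<gamma> \<theta> x"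
    unfolding drift_F_def using assms(4) by (intro mult_left_mono) auto
  moreover have "(\<theta> - 1) * (1 / 2 * b\<^sup>2 * \<theta> * inverse x - am1)
      = (\<theta> - 1) * (1 / 2 * b\<^sup>2 * \<theta>) / x - (\<theta> - 1) * am1"
    by (simp only: divide_inverse right_diff_distrib mult.assoc)
  ultimately show ?thesis by simp
qed

lemma drift_F_bounded:
  assumes "0 < r"
  obtains B where "\<And>x. r \<le> x \<Longrightarrow> x \<le> 1 \<Longrightarrow> \<bar>drift_F am1 a0 a2 b \<gamma> \<theta> x\<bar> \<le> B"
proof -
  have "continuous_on {r..1} (drift_F am1 a0 a2 b \<gamma> \<theta>)"
    unfolding drift_F_def[abs_def] using assms by (intro continuous_intros) auto
  from continuous_on_Icc_bounded[OF this] show thesis using that by (metis atLeastAtMost_iff)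
qed

lemma proposal_alt:
  "proposal am1 a0 a1 a2 b \<gamma> \<theta> \<tau> y g =
    exp (- ((\<theta> - 1) * a1) * \<tau>) * (y + \<tau> * (drift_F am1 a0 a2 b \<gamma> \<theta> y
      / (1 + \<tau> * \<bar>drift_F am1 a0 a2 b \<gamma> \<theta> y\<bar>\<^sup>2)) - b * (\<theta> - 1) * g)"
  unfolding proposal_def tamed_F_def by (simp add: algebra_simps)

text \<open>
  The scheme prescribes measurability of the approximations only; the proposals inherit it.
\<close>

lemma (in brownian_motion) proposals_adapted:
  assumes \<tau>: "0 < \<tau>"
    and scheme: "tamed_splitting_backstop M Fil W am1 a0 a1 a2 b \<gamma> \<theta> \<tau> N Y0 Y Ys"
    and n: "n \<le> N"
  shows "Ys n \<in> borel_measurable (Fil (real n * \<tau>))"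
proof -
  have sp: "space (Fil (real k * \<tau>)) = space M" for k
    using subalgebra_Fil[of "real k * \<tau>"] \<tau> by (simp add: subalgebra_def)
  show ?thesis
  proof (cases n)
    case 0
    have "Ys 0 \<omega> = Y0" if "\<omega> \<in> space (Fil (real n * \<tau>))" for \<omega>
      using scheme that unfolding tamed_splitting_backstop_def sp by blast
    then show ?thesis unfolding \<open>n = 0\<close> by (subst measurable_cong) auto
  next
    case (Suc k)
    have k: "k < N" using n Suc by simp
    let ?t = "real n * \<tau>" and ?s = "real k * \<tau>"
    have "subalgebra (Fil ?t) (Fil ?s)"
      unfolding subalgebra_def sp using \<tau> Suc mono_Fil[of ?s ?t] by simp
    note lift = measurable_from_subalg[OF this]
    have "Y k \<in> borel_measurable (Fil ?s)"
    proof (cases k)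
      case 0
      have "Y 0 \<omega> = Y0" if "\<omega> \<in> space (Fil ?s)" for \<omega>
        using scheme that unfolding tamed_splitting_backstop_def sp by blast
      then show ?thesis unfolding \<open>k = 0\<close> by (subst measurable_cong) auto
    next
      case (Suc j)
      then show ?thesis using scheme k unfolding tamed_splitting_backstop_def by auto
    qed
    then have [measurable]: "Y k \<in> borel_measurable (Fil ?t)" by (rule lift)
    have [measurable]: "W ?s \<in> borel_measurable (Fil ?t)" "W ?t \<in> borel_measurable (Fil ?t)"
      using lift[OF adapted] adapted[of ?t] \<tau> by simp_all
    have "Ys n \<omega> = proposal am1 a0 a1 a2 b \<gamma> \<theta> \<tau> (Y k \<omega>) (W ?t \<omega> - W ?s \<omega>)"
      if "\<omega> \<in> space (Fil ?t)" for \<omega>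
      using scheme k that unfolding tamed_splitting_backstop_def sp Suc Let_def by blast
    moreover have "(\<lambda>\<omega>. proposal am1 a0 a1 a2 b \<gamma> \<theta> \<tau> (Y k \<omega>) (W ?t \<omega> - W ?s \<omega>))
        \<in> borel_measurable (Fil ?t)"
      unfolding proposal_def tamed_F_def drift_F_def by measurable
    ultimately show ?thesis by (subst measurable_cong)
  qed
qed

theorem theorem2:
  fixes M :: "'w measure" and Fil :: "real \<Rightarrow> 'w measure" and W :: "real \<Rightarrow> 'w \<Rightarrow> real"
    and am1 a0 a1 a2 b \<gamma> \<theta> T Y0 M1 :: real
    and Y Ys :: "nat \<Rightarrow> nat \<Rightarrow> 'w \<Rightarrow> real"
  assumes "brownian_motion M Fil W"
    and "0 < am1" "0 < a0" "0 < a1" "0 < a2" "0 < b" "1 < \<gamma>" "1 < \<theta>" "0 < T"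
    and "0 < Y0" "Y0 \<le> M1"
    and "\<And>N. 0 < N \<Longrightarrow>
      tamed_splitting_backstop M Fil W am1 a0 a1 a2 b \<gamma> \<theta> (T / real N) N Y0 (Y N) (Ys N)"
  shows "\<forall>\<epsilon>\<in>{0<..<1}. \<exists>\<tau>>0. \<exists>N>0. \<tau> = T / real N \<and>
    measure M (all_proposals_positive M N (Ys N)) > 1 - \<epsilon>"
proof
  fix \<epsilon> :: real assume \<epsilon>: "\<epsilon> \<in> {0<..<1}"
  interpret brownian_motion M Fil W by fact
  define \<sigma> where "\<sigma> = b * (\<theta> - 1)"
  define \<mu> where "\<mu> = (\<theta> - 1) * a1"
  define c where "c = (\<theta> - 1) * (1 / 2 * b\<^sup>2 * \<theta>)"
  define C1 where "C1 = (\<theta> - 1) * am1"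
  define K where "K = (3 * c + (C1 + \<mu> + 1))\<^sup>2 / (4 * (c - \<sigma>\<^sup>2 / 2))"
  let ?F = "drift_F am1 a0 a2 b \<gamma> \<theta>"
  have \<sigma>: "0 < \<sigma>" and \<mu>: "0 \<le> \<mu>" and C1: "0 \<le> C1"
    using assms by (simp_all add: \<sigma>_def \<mu>_def C1_def)
  have "c - \<sigma>\<^sup>2 / 2 = (\<theta> - 1) * b\<^sup>2 / 2"
    unfolding c_def \<sigma>_def by (simp add: power2_eq_square field_simps)
  moreover have "0 < (\<theta> - 1) * b\<^sup>2 / 2" using assms by simp
  ultimately have c: "\<sigma>\<^sup>2 / 2 < c" by linarith
  have K: "0 \<le> K" unfolding K_def using c by simp
  define v0 where "v0 = (if 1 \<le> Y0 then 0 else log_barrier Y0)"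
  define P where "P = (v0 + T * (K + 1)) / \<epsilon>"
  have v0: "0 \<le> v0" unfolding v0_def using log_barrier_nonneg assms by simp
  have P: "0 \<le> P" unfolding P_def using v0 K assms \<epsilon> by simp
  (* Chosen so that the barrier at 2 r is larger than P, the level at which the bound on the crossing
     probability drops below \<epsilon>, and so that the scheme starts above 2 r. *)
  define r where "r = min (min Y0 1) (exp (- (P + 3))) / 2"
  have r: "0 < r" "2 * r \<le> 1" "2 * r \<le> Y0" "2 * r \<le> exp (- (P + 3))"
    unfolding r_def using \<open>0 < Y0\<close> exp_gt_zero[of "- (P + 3)"] by linarith+
  define H where "H = log_barrier (2 * r)"
  have "ln (2 * r) \<le> - (P + 3)" using r ln_le_cancel_iff[of "2 * r" "exp (- (P + 3))"] by simp
  then have HP: "P < H" unfolding H_def using log_barrier_ge_minus_ln[of "2 * r"] r by simp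
  have H: "0 < H" using HP P by simp
  have lower: "c / y - C1 \<le> ?F y" if "0 < y" "y \<le> 1" for y
    unfolding c_def C1_def using drift_F_lower assms that by blast
  obtain B where B: "\<And>y. 2 * r \<le> y \<Longrightarrow> y \<le> 1 \<Longrightarrow> \<bar>?F y\<bar> \<le> B"
    by (rule drift_F_bounded[of "2 * r" am1 a0 a2 b \<gamma> \<theta>]) (use r in auto)
  obtain \<tau>0 C where \<tau>0: "0 < \<tau>0" and C: "0 \<le> C" and one_step:
    "\<And>\<tau> y g. 0 < \<tau> \<Longrightarrow> \<tau> \<le> \<tau>0 \<Longrightarrow> 2 * r \<le> y \<Longrightarrow>
      capped_barrier r (exp (- \<mu> * \<tau>) * (y + \<tau> * (?F y / (1 + \<tau> * \<bar>?F y\<bar>\<^sup>2)) - \<sigma> * g))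
      \<le> capped_barrier r y + \<tau> * K
        + step_linear_coeff r c (C1 + \<mu> + 1) \<tau> (exp (- \<mu> * \<tau>) * \<sigma>) y * g
        + step_quadratic_coeff r (exp (- \<mu> * \<tau>) * \<sigma>) y * (g\<^sup>2 - \<tau>)
        + C * (\<tau> * sqrt \<tau> + \<bar>g\<bar> ^ 3)"
    using tamed_step_barrier[OF r(1,2) \<mu> \<sigma> c C1 lower B] unfolding K_def by blast
  (* The second entry makes the accumulated error 3 C T sqrt \<tau> at most T: a C from the deterministic
     part \<tau> sqrt \<tau> of the one-step error, and 2 C from the third moment of the increment. *)
  define e where "e = min \<tau>0 ((1 / (3 * C + 1))\<^sup>2)"
  have e: "0 < e" unfolding e_def using \<tau>0 C by simp
  obtain N :: nat where N: "T / e < real N" using reals_Archimedean2 by blast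
  have N0: "0 < N" using N e assms by (cases N) (auto simp: divide_less_0_iff)
  define \<tau> where "\<tau> = T / real N"
  have \<tau>: "0 < \<tau>" "\<tau> \<le> \<tau>0" "\<tau> \<le> (1 / (3 * C + 1))\<^sup>2" and N\<tau>: "real N * \<tau> = T"
  proof -
    have "\<tau> \<le> e" unfolding \<tau>_def using N N0 e by (simp add: field_simps)
    then show "\<tau> \<le> \<tau>0" "\<tau> \<le> (1 / (3 * C + 1))\<^sup>2" unfolding e_def by auto
  qed (use N0 assms in \<open>auto simp: \<tau>_def\<close>)
  have "sqrt \<tau> \<le> 1 / (3 * C + 1)" using \<tau>(3) C by (intro real_le_lsqrt) auto
  then have "3 * C * sqrt \<tau> \<le> 3 * C * (1 / (3 * C + 1))" using C by (intro mult_left_mono) auto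
  also have "\<dots> \<le> 1" using C by (simp add: pos_divide_le_eq)
  finally have small: "3 * C * sqrt \<tau> \<le> 1" .
  have scheme: "tamed_splitting_backstop M Fil W am1 a0 a1 a2 b \<gamma> \<theta> \<tau> N Y0 (Y N) (Ys N)"
    using assms(12)[OF N0] by (simp add: \<tau>_def)
  have start: "Y N 0 \<omega> = Y0" "Ys N 0 \<omega> = Y0" if "\<omega> \<in> space M" for \<omega>
    using scheme that unfolding tamed_splitting_backstop_def by auto
  have accepted: "Y N n \<omega> = Ys N n \<omega>" if "\<omega> \<in> space M" "n \<le> N" "0 < Ys N n \<omega>" for n \<omega>
    using that scheme start[OF that(1)] unfolding tamed_splitting_backstop_def Let_def
    by (cases n) auto
  have adapted_Ys: "Ys N n \<in> borel_measurable (Fil (real n * \<tau>))" if "n \<le> N" for n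
    using proposals_adapted[OF \<tau>(1) scheme that] .
  define s where "s = exp (- \<mu> * \<tau>) * \<sigma>"
  let ?L = "step_linear_coeff r c (C1 + \<mu> + 1) \<tau> s"
  let ?Q = "step_quadratic_coeff r s"
  obtain D where D: "\<And>y. \<bar>?L y\<bar> \<le> D" "\<And>y. \<bar>?Q y\<bar> \<le> D"
    using step_coeffs_bounded[OF r(1), where c = c and C = "C1 + \<mu> + 1" and \<tau> = \<tau> and s = s]
    by blast
  let ?A = "{\<omega> \<in> space M. \<forall>j\<le>N. 2 * r \<le> Ys N j \<omega>}"
  have "H * (1 - prob ?A) \<le> v0 + real N * (\<tau> * K + C * (\<tau> * sqrt \<tau>) + 2 * C * (\<tau> * sqrt \<tau>))"
  proof (rule level_crossing_prob_le[where V = "capped_barrier r" and L = ?L and Q = ?Q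
        and D = "max D (log_barrier r)"])
    show "2 * r \<le> Ys N 0 \<omega>" if "\<omega> \<in> space M" for \<omega> using start[OF that] r by simp
    show "capped_barrier r (Ys N 0 \<omega>) \<le> v0" if "\<omega> \<in> space M" for \<omega>
      using start[OF that] r by (auto simp: v0_def capped_barrier_eq)
    show "H \<le> capped_barrier r x" if "x < 2 * r" for x
      using capped_barrier_antimono[of r x "2 * r"] capped_barrier_eq[of r "2 * r"] r that
      unfolding H_def by simp
    show "capped_barrier r x \<le> max D (log_barrier r)" for x
      using capped_barrier_le[of r x] r by simp
    show "\<bar>?L x\<bar> \<le> max D (log_barrier r)" "\<bar>?Q x\<bar> \<le> max D (log_barrier r)" for x
      using D[of x] by simp_all
    fix n \<omega>
    assume n: "n < N" and \<omega>: "\<omega> \<in> space M" and above: "\<forall>j\<le>n. 2 * r \<le> Ys N j \<omega>"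
    let ?g = "W (real (Suc n) * \<tau>) \<omega> - W (real n * \<tau>) \<omega>"
    have y: "2 * r \<le> Ys N n \<omega>" using above by simp
    have "Ys N (Suc n) \<omega> = proposal am1 a0 a1 a2 b \<gamma> \<theta> \<tau> (Y N n \<omega>) ?g"
      using scheme n \<omega> unfolding tamed_splitting_backstop_def Let_def by blast
    also have "Y N n \<omega> = Ys N n \<omega>" using accepted[OF \<omega>] n y r by simp
    finally have next_value: "Ys N (Suc n) \<omega> = proposal am1 a0 a1 a2 b \<gamma> \<theta> \<tau> (Ys N n \<omega>) ?g" .
    show "capped_barrier r (Ys N (Suc n) \<omega>) \<le> capped_barrier r (Ys N n \<omega>)
        + (\<tau> * K + C * (\<tau> * sqrt \<tau>)) + ?L (Ys N n \<omega>) * ?g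
        + ?Q (Ys N n \<omega>) * (?g\<^sup>2 - \<tau>) + C * \<bar>?g\<bar> ^ 3"
      using one_step[OF \<tau>(1,2) y, of ?g]
      unfolding next_value proposal_alt \<mu>_def[symmetric] \<sigma>_def[symmetric] s_def distrib_left
      by linarith
  qed (use \<tau> K C r adapted_Ys capped_barrier_nonneg in auto)
  also have "real N * (\<tau> * K + C * (\<tau> * sqrt \<tau>) + 2 * C * (\<tau> * sqrt \<tau>))
      = T * (K + 3 * C * sqrt \<tau>)"
    unfolding N\<tau>[symmetric] by (simp add: algebra_simps)
  also have "v0 + \<dots> \<le> v0 + T * (K + 1)"
    using small assms by simp
  also have "\<dots> = P * \<epsilon>" using \<epsilon> by (simp add: P_def)
  also have "\<dots> < H * \<epsilon>" using HP \<epsilon> by simp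
  finally have "1 - \<epsilon> < prob ?A" using H by simp
  also have "\<dots> \<le> prob (all_proposals_positive M N (Ys N))"
  proof (rule finite_measure_mono)
    show "?A \<subseteq> all_proposals_positive M N (Ys N)"
      unfolding all_proposals_positive_def using r by force
    have "Ys N j \<in> borel_measurable M" if "j \<le> N" for j
      using measurable_Fil_imp_measurable[OF _ adapted_Ys[OF that]] \<tau> by simp
    then show "all_proposals_positive M N (Ys N) \<in> events"
      unfolding all_proposals_positive_def
      by (intro sets.finite_INT) (auto intro: borel_measurable_less[OF borel_measurable_const])
  qed
  finally show "\<exists>\<tau>>0. \<exists>N>0. \<tau> = T / real N \<and>
      measure M (all_proposals_positive M N (Ys N)) > 1 - \<epsilon>"
    using \<tau>(1) N0 \<tau>_def by blast
qed

end
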